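(* Let $p$ be a prime, let $(G,+)$ be a finite abelian $p$-group, and let $A=(G,+,\cdot)$ be a commutative, associative, nilpotent ring structure on $(G,+)$. Let $\Gamma$ be a finite abelian $p$-group with an isomorphism $\xi:\Gamma\to(G,\circ)$, and let $\alpha:(G,+)\to\mathrm{Perm}(\Gamma)$ be the regular embedding yielded by $A$ (and $\xi$), whose image is normalized by $\lambda(\Gamma)$. Then the lattice (under inclusion) of $\lambda(\Gamma)$-invariant subgroups of $\alpha(G)$ is isomorphic to the lattice (under inclusion) of ideals of $A$.
   Context: Rings here need not have a unit; $A$ nilpotent means $A^m=0$ for some $m\ge1$. The operation $\circ$ on $G$ is $g\circ h=g+h+g\cdot h$; it makes $G$ into an abelian group $(G,\circ)$ with identity $0$. $\mathrm{Perm}(X)$ is the group of permutations of the set $X$. $\lambda$ denotes the left regular representation: $\lambda(\gamma)(\delta)=\gamma\delta$ on $\Gamma$, and $\lambda_G(g)(x)=g+x$ on $(G,+)$. A subgroup of $\mathrm{Perm}(X)$ is regular if it acts simply transitively on $X$; a regular embedding is an injective group homomorphism with regular image. The regular embedding $\alpha$ yielded by $A$ is constructed as follows. Define $\tau:(G,\circ)\to\mathrm{Perm}(G)$ by $\tau(g)(x)=g\circ x$; its image is a regular subgroup of $\mathrm{Hol}(G,+)$, the normalizer of $\lambda_G(G)$ in $\mathrm{Perm}(G)$. Put $\beta=\tau\xi:\Gamma\to\mathrm{Hol}(G,+)$ and $b(\gamma)=\beta(\gamma)(0)$, so that $b=\xi$ as a map $\Gamma\to G$. Then $\alpha:(G,+)\to\mathrm{Perm}(\Gamma)$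 is $\alpha(g)=b^{-1}\lambda_G(g)b$, i.e. $\alpha(g)(\gamma)=\xi^{-1}(g+\xi(\gamma))$. A subgroup $M\subseteq\alpha(G)$ is $\lambda(\Gamma)$-invariant if it is normalized by $\lambda(\Gamma)$, i.e. $\lambda(\gamma)M\lambda(\gamma)^{-1}=M$ for all $\gamma\in\Gamma$. An ideal of $A$ is an additive subgroup $J$ with $a\cdot j\in J$ for all $a\in A$, $j\in J$. *)

theory Defs
  imports
    "HOL-Algebra.Ideal"
    "HOL-Algebra.Generated_Groups"
    "HOL-Algebra.Bij"
    "HOL-Algebra.Lattice"
    "HOL-Computational_Algebra.Primes"
begin

text \<open>
  A commutative associative ring not required to have a unit. It is carried by a record of
  HOL-Algebra's type of rings, whose \<open>one\<close> field is left unconstrained and never used.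
\<close>

locale comm_rng = abelian_group A for A (structure) +
  assumes rng_m_closed: "\<lbrakk>x \<in> carrier A; y \<in> carrier A\<rbrakk> \<Longrightarrow> x \<otimes> y \<in> carrier A"
    and rng_m_assoc:
      "\<lbrakk>x \<in> carrier A; y \<in> carrier A; z \<in> carrier A\<rbrakk> \<Longrightarrow> (x \<otimes> y) \<otimes> z = x \<otimes> (y \<otimes> z)"
    and rng_m_comm: "\<lbrakk>x \<in> carrier A; y \<in> carrier A\<rbrakk> \<Longrightarrow> x \<otimes> y = y \<otimes> x"
    and rng_l_distr:
      "\<lbrakk>x \<in> carrier A; y \<in> carrier A; z \<in> carrier A\<rbrakk> \<Longrightarrow> (x \<oplus> y) \<otimes> z = x \<otimes> z \<oplus> y \<otimes> z"

text \<open>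
  The powers of the ring as subgroups of its additive group: the first power is \<open>A\<close>, and the
  \<open>(m + 1)\<close>st is the additive span of the products of an element of the \<open>m\<close>th power with an
  element of \<open>A\<close>. The value at \<open>0\<close> is a mere convention.
\<close>

fun rng_power :: "('a, 'm) ring_scheme \<Rightarrow> nat \<Rightarrow> 'a set" where
  "rng_power A 0 = carrier A"
| "rng_power A (Suc 0) = carrier A"
| "rng_power A (Suc (Suc m)) =
     generate (add_monoid A) {x \<otimes>\<^bsub>A\<^esub> a | x a. x \<in> rng_power A (Suc m) \<and> a \<in> carrier A}"

definition nilpotent_rng :: "('a, 'm) ring_scheme \<Rightarrow> bool" where
  "nilpotent_rng A \<longleftrightarrow> (\<exists>m\<ge>1. rng_power A m = {\<zero>\<^bsub>A\<^esub>})"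

definition rng_ideal :: "'a set \<Rightarrow> ('a, 'm) ring_scheme \<Rightarrow> bool" where
  "rng_ideal J A \<longleftrightarrow> additive_subgroup J A \<and> (\<forall>a\<in>carrier A. \<forall>j\<in>J. a \<otimes>\<^bsub>A\<^esub> j \<in> J)"

definition finite_p_group :: "nat \<Rightarrow> ('a, 'm) monoid_scheme \<Rightarrow> bool" where
  "finite_p_group p H \<longleftrightarrow> group H \<and> finite (carrier H) \<and> (\<exists>n. order H = p ^ n)"

definition circle_group :: "('a, 'm) ring_scheme \<Rightarrow> 'a monoid" where
  "circle_group A =
     \<lparr>carrier = carrier A, monoid.mult = (\<lambda>g h. g \<oplus>\<^bsub>A\<^esub> h \<oplus>\<^bsub>A\<^esub> g \<otimes>\<^bsub>A\<^esub> h), one = \<zero>\<^bsub>A\<^esub>\<rparr>"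

text \<open>
  The permutation group of a set \<open>S\<close> is \<open>BijGroup S\<close>, whose elements are the bijections of \<open>S\<close>
  taken as functions that are \<open>undefined\<close> outside \<open>S\<close>; hence the restricted abstractions below.
\<close>

definition left_regular :: "('a, 'm) monoid_scheme \<Rightarrow> 'a \<Rightarrow> 'a \<Rightarrow> 'a" where
  "left_regular H g = (\<lambda>x\<in>carrier H. g \<otimes>\<^bsub>H\<^esub> x)"

definition regular_subgroup :: "'a set \<Rightarrow> ('a \<Rightarrow> 'a) set \<Rightarrow> bool" where
  "regular_subgroup S N \<longleftrightarrow>
     subgroup N (BijGroup S) \<and> (\<forall>x\<in>S. \<forall>y\<in>S. \<exists>!f. f \<in> N \<and> f x = y)"

definition regular_embedding :: "('a, 'm) monoid_scheme \<Rightarrow> 'b set \<Rightarrow> ('a \<Rightarrow> 'b \<Rightarrow> 'b) \<Rightarrow> bool" where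
  "regular_embedding H S \<phi> \<longleftrightarrow>
     \<phi> \<in> hom H (BijGroup S) \<and> inj_on \<phi> (carrier H) \<and> regular_subgroup S (\<phi> ` carrier H)"

definition circle_tau :: "('a, 'm) ring_scheme \<Rightarrow> 'a \<Rightarrow> 'a \<Rightarrow> 'a" where
  "circle_tau A g = left_regular (circle_group A) g"

definition yielded_beta :: "('a, 'm) ring_scheme \<Rightarrow> ('b \<Rightarrow> 'a) \<Rightarrow> 'b \<Rightarrow> 'a \<Rightarrow> 'a" where
  "yielded_beta A \<xi> \<gamma> = circle_tau A (\<xi> \<gamma>)"

definition yielded_b :: "('a, 'm) ring_scheme \<Rightarrow> ('b \<Rightarrow> 'a) \<Rightarrow> 'b \<Rightarrow> 'a" where
  "yielded_b A \<xi> \<gamma> = yielded_beta A \<xi> \<gamma> \<zero>\<^bsub>A\<^esub>"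

definition yielded_embedding ::
  "('a, 'm) ring_scheme \<Rightarrow> ('b, 'n) monoid_scheme \<Rightarrow> ('b \<Rightarrow> 'a) \<Rightarrow> 'a \<Rightarrow> 'b \<Rightarrow> 'b" where
  "yielded_embedding A \<Gamma> \<xi> g =
     (\<lambda>\<gamma>\<in>carrier \<Gamma>.
        inv_into (carrier \<Gamma>) (yielded_b A \<xi>)
          (left_regular (add_monoid A) g (yielded_b A \<xi> \<gamma>)))"

definition lambda_invariant :: "('b, 'n) monoid_scheme \<Rightarrow> ('b \<Rightarrow> 'b) set \<Rightarrow> bool" where
  "lambda_invariant \<Gamma> M \<longleftrightarrow>
     (\<forall>\<gamma>\<in>carrier \<Gamma>.
        left_regular \<Gamma> \<gamma> <#\<^bsub>BijGroup (carrier \<Gamma>)\<^esub> M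
          #>\<^bsub>BijGroup (carrier \<Gamma>)\<^esub> inv\<^bsub>BijGroup (carrier \<Gamma>)\<^esub> left_regular \<Gamma> \<gamma> = M)"

definition inclusion_order :: "'a set set \<Rightarrow> 'a set gorder" where
  "inclusion_order S = \<lparr>carrier = S, eq = (=), le = (\<subseteq>)\<rparr>"

definition invariant_subgroup_lattice ::
  "('b, 'n) monoid_scheme \<Rightarrow> ('b \<Rightarrow> 'b) set \<Rightarrow> ('b \<Rightarrow> 'b) set gorder" where
  "invariant_subgroup_lattice \<Gamma> N =
     inclusion_order
       {M. subgroup M (BijGroup (carrier \<Gamma>)) \<and> M \<subseteq> N \<and> lambda_invariant \<Gamma> M}"

definition ideal_lattice :: "('a, 'm) ring_scheme \<Rightarrow> 'a set gorder" where
  "ideal_lattice A = inclusion_order {J. rng_ideal J A}"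

text \<open>
  Being lattices is part of \<open>join_pres\<close> and \<open>meet_pres\<close>.
\<close>

definition lattice_isomorphic ::
  "('a, 'm) gorder_scheme \<Rightarrow> ('b, 'n) gorder_scheme \<Rightarrow> bool" where
  "lattice_isomorphic K L \<longleftrightarrow>
     (\<exists>\<Phi>. bij_betw \<Phi> (carrier K) (carrier L) \<and> join_pres K L \<Phi> \<and> meet_pres K L \<Phi>)"


text \<open>
  The construction does yield a regular embedding with image normalized by the left regular
  representation; these are consequences, not hypotheses.
\<close>

lemma Bij_group_mult:
  "\<lbrakk>f \<in> Bij S; g \<in> Bij S\<rbrakk> \<Longrightarrow> f \<otimes>\<^bsub>BijGroup S\<^esub> g = compose S f g"
  by (simp add: BijGroup_def)

lemma left_regular_Bij:
  assumes "group H" "g \<in> carrier H"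
  shows "left_regular H g \<in> Bij (carrier H)"
proof -
  interpret group H by fact
  have "bij_betw (\<lambda>x. g \<otimes>\<^bsub>H\<^esub> x) (carrier H) (carrier H)"
    by (rule bij_betwI[where g = "\<lambda>x. inv\<^bsub>H\<^esub> g \<otimes>\<^bsub>H\<^esub> x"])
      (use assms in \<open>auto simp: m_assoc[symmetric]\<close>)
  then show ?thesis
    by (simp add: Bij_def left_regular_def)
qed

context
  fixes A :: "('a, 'm) ring_scheme" (structure) and \<Gamma> :: "('b, 'n) monoid_scheme" and \<xi>
  assumes A: "comm_rng A" and \<Gamma>: "group \<Gamma>" and \<xi>: "\<xi> \<in> iso \<Gamma> (circle_group A)"
begin

interpretation A: comm_rng A by (rule A)
interpretation \<Gamma>: group \<Gamma> by (rule \<Gamma>)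

lemma xi_bij: "bij_betw \<xi> (carrier \<Gamma>) (carrier A)"
  using \<xi> by (simp add: iso_def circle_group_def)

lemma xi_closed: "\<gamma> \<in> carrier \<Gamma> \<Longrightarrow> \<xi> \<gamma> \<in> carrier A"
  using xi_bij bij_betwE by blast

lemma xi_mult:
  "\<lbrakk>\<gamma> \<in> carrier \<Gamma>; \<delta> \<in> carrier \<Gamma>\<rbrakk> \<Longrightarrow> \<xi> (\<gamma> \<otimes>\<^bsub>\<Gamma>\<^esub> \<delta>) = \<xi> \<gamma> \<oplus> \<xi> \<delta> \<oplus> \<xi> \<gamma> \<otimes> \<xi> \<delta>"
  using \<xi> by (simp add: iso_def hom_def circle_group_def)

lemma rng_r_distr:
  assumes "x \<in> carrier A" "y \<in> carrier A" "z \<in> carrier A"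
  shows "x \<otimes> (y \<oplus> z) = x \<otimes> y \<oplus> x \<otimes> z"
  using assms A.rng_l_distr[of y z x] by (simp add: A.rng_m_comm)

lemma rng_r_zero:
  assumes "x \<in> carrier A" shows "x \<otimes> \<zero> = \<zero>"
  using assms rng_r_distr[of x \<zero> \<zero>] A.rng_m_closed[of x \<zero>]
  by simp

lemma yielded_b_eq: "\<gamma> \<in> carrier \<Gamma> \<Longrightarrow> yielded_b A \<xi> \<gamma> = \<xi> \<gamma>"
  using xi_closed[of \<gamma>]
  by (simp add: yielded_b_def yielded_beta_def circle_tau_def left_regular_def circle_group_def
      rng_r_zero)

lemma yielded_embedding_eq:
  assumes "g \<in> carrier A"
  shows "yielded_embedding A \<Gamma> \<xi> g = (\<lambda>\<gamma>\<in>carrier \<Gamma>. inv_into (carrier \<Gamma>) \<xi> (g \<oplus> \<xi> \<gamma>))"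
proof -
  have *: "inv_into (carrier \<Gamma>) (yielded_b A \<xi>) y = inv_into (carrier \<Gamma>) \<xi> y" for y
    unfolding inv_into_def by (metis yielded_b_eq)
  show ?thesis
    by (auto simp: yielded_embedding_def * left_regular_def yielded_b_eq xi_closed)
qed

lemma yielded_embedding_apply:
  assumes "g \<in> carrier A" "\<gamma> \<in> carrier \<Gamma>"
  shows "yielded_embedding A \<Gamma> \<xi> g \<gamma> \<in> carrier \<Gamma>"
    and "\<xi> (yielded_embedding A \<Gamma> \<xi> g \<gamma>) = g \<oplus> \<xi> \<gamma>"
proof -
  have "g \<oplus> \<xi> \<gamma> \<in> \<xi> ` carrier \<Gamma>"
    using assms xi_closed xi_bij by (simp add: bij_betw_def)
  then show "yielded_embedding A \<Gamma> \<xi> g \<gamma> \<in> carrier \<Gamma>"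
    "\<xi> (yielded_embedding A \<Gamma> \<xi> g \<gamma>) = g \<oplus> \<xi> \<gamma>"
    using assms by (simp_all add: yielded_embedding_eq inv_into_into f_inv_into_f)
qed

lemma xi_inj: "\<lbrakk>\<xi> \<gamma> = \<xi> \<delta>; \<gamma> \<in> carrier \<Gamma>; \<delta> \<in> carrier \<Gamma>\<rbrakk> \<Longrightarrow> \<gamma> = \<delta>"
  using xi_bij by (auto simp: bij_betw_def inj_on_def)

lemma yielded_embedding_Bij:
  assumes "g \<in> carrier A" shows "yielded_embedding A \<Gamma> \<xi> g \<in> Bij (carrier \<Gamma>)"
proof -
  have 1: "yielded_embedding A \<Gamma> \<xi> g (yielded_embedding A \<Gamma> \<xi> h \<gamma>) = \<gamma>"
    if "g \<in> carrier A" "h \<in> carrier A" "g \<oplus> h = \<zero>" "\<gamma> \<in> carrier \<Gamma>" for g h \<gamma>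
    using that
    by (intro xi_inj) (simp_all add: yielded_embedding_apply A.a_assoc[symmetric] xi_closed)
  have "bij_betw (yielded_embedding A \<Gamma> \<xi> g) (carrier \<Gamma>) (carrier \<Gamma>)"
    by (rule bij_betwI[where g = "yielded_embedding A \<Gamma> \<xi> (\<ominus> g)"])
      (use assms in \<open>auto simp: yielded_embedding_apply 1 A.r_neg A.l_neg\<close>)
  then show ?thesis
    by (simp add: Bij_def yielded_embedding_def)
qed

theorem yielded_embedding_regular:
  "regular_embedding (add_monoid A) (carrier \<Gamma>) (yielded_embedding A \<Gamma> \<xi>)"
proof -
  let ?\<alpha> = "yielded_embedding A \<Gamma> \<xi>" and ?B = "BijGroup (carrier \<Gamma>)"
  have mult: "?\<alpha> (g \<oplus> h) = ?\<alpha> g \<otimes>\<^bsub>?B\<^esub> ?\<alpha> h" if "g \<in> carrier A" "h \<in> carrier A" for g h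
  proof -
    have "?\<alpha> (g \<oplus> h) \<gamma> = compose (carrier \<Gamma>) (?\<alpha> g) (?\<alpha> h) \<gamma>" for \<gamma>
    proof (cases "\<gamma> \<in> carrier \<Gamma>")
      case True
      then show ?thesis using that
        by (intro xi_inj) (simp_all add: compose_eq yielded_embedding_apply A.a_assoc xi_closed)
    qed (simp add: compose_def yielded_embedding_def)
    then show ?thesis
      using that by (auto simp: Bij_group_mult yielded_embedding_Bij)
  qed
  have hom: "?\<alpha> \<in> hom (add_monoid A) ?B"
    using mult yielded_embedding_Bij by (auto simp: hom_def BijGroup_def)
  have inj: "g = h"
    if "g \<in> carrier A" "h \<in> carrier A" "\<gamma> \<in> carrier \<Gamma>" "?\<alpha> g \<gamma> = ?\<alpha> h \<gamma>" for g h \<gamma>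
  proof -
    have "g \<oplus> \<xi> \<gamma> = h \<oplus> \<xi> \<gamma>"
      using that by (simp flip: yielded_embedding_apply(2))
    then show ?thesis
      using that by (simp add: xi_closed)
  qed
  have "subgroup (?\<alpha> ` carrier A) ?B"
    using group_hom.img_is_subgroup[of "add_monoid A" ?B ?\<alpha>] hom group_BijGroup
      A.a_group by (auto simp: group_hom_def group_hom_axioms_def)
  moreover have "\<exists>!f. f \<in> ?\<alpha> ` carrier A \<and> f \<gamma> = \<delta>"
    if \<gamma>: "\<gamma> \<in> carrier \<Gamma>" and \<delta>: "\<delta> \<in> carrier \<Gamma>" for \<gamma> \<delta>
  proof -
    define g where "g = \<xi> \<delta> \<ominus> \<xi> \<gamma>"
    have g: "g \<in> carrier A"
      using \<gamma> \<delta> by (simp add: g_def xi_closed)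
    have eq: "?\<alpha> g \<gamma> = \<delta>"
      using \<gamma> \<delta> by (intro xi_inj)
        (simp_all add: g_def yielded_embedding_apply xi_closed A.a_assoc A.minus_eq A.l_neg)
    show ?thesis
    proof (rule ex1I[of _ "?\<alpha> g"])
      show "?\<alpha> g \<in> ?\<alpha> ` carrier A \<and> ?\<alpha> g \<gamma> = \<delta>"
        using g eq by (intro conjI imageI)
    next
      fix f assume "f \<in> ?\<alpha> ` carrier A \<and> f \<gamma> = \<delta>"
      then obtain h where h: "h \<in> carrier A" "f = ?\<alpha> h" "?\<alpha> h \<gamma> = \<delta>"
        by (elim conjE imageE) simp
      have "h = g"
        by (rule inj[OF h(1) g \<gamma>]) (simp add: eq h(3))
      then show "f = ?\<alpha> g"
        using h(2) by simp
    qed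
  qed
  moreover have "inj_on ?\<alpha> (carrier A)"
    by (rule inj_onI) (erule (1) inj[OF _ _ \<Gamma>.one_closed], simp)
  ultimately show ?thesis
    using hom unfolding regular_embedding_def regular_subgroup_def by simp
qed

lemma left_regular_yielded_embedding:
  assumes "\<gamma> \<in> carrier \<Gamma>" "g \<in> carrier A"
  shows "left_regular \<Gamma> \<gamma> \<otimes>\<^bsub>BijGroup (carrier \<Gamma>)\<^esub> yielded_embedding A \<Gamma> \<xi> g
       = yielded_embedding A \<Gamma> \<xi> (g \<oplus> \<xi> \<gamma> \<otimes> g)
           \<otimes>\<^bsub>BijGroup (carrier \<Gamma>)\<^esub> left_regular \<Gamma> \<gamma>"
proof -
  note [simp] = assms xi_closed A.rng_m_closed
  have "compose (carrier \<Gamma>) (left_regular \<Gamma> \<gamma>) (yielded_embedding A \<Gamma> \<xi> g) \<delta>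
      = compose (carrier \<Gamma>) (yielded_embedding A \<Gamma> \<xi> (g \<oplus> \<xi> \<gamma> \<otimes> g)) (left_regular \<Gamma> \<gamma>) \<delta>" for \<delta>
  proof (cases "\<delta> \<in> carrier \<Gamma>")
    case True
    then show ?thesis
      by (intro xi_inj) (simp_all add: compose_eq yielded_embedding_apply left_regular_def xi_mult
          rng_r_distr A.a_ac)
  qed (simp add: compose_def)
  then show ?thesis
    by (auto simp: Bij_group_mult yielded_embedding_Bij left_regular_Bij \<Gamma>)
qed

theorem yielded_embedding_lambda_invariant:
  "lambda_invariant \<Gamma> (yielded_embedding A \<Gamma> \<xi> ` carrier A)"
proof -
  let ?\<alpha> = "yielded_embedding A \<Gamma> \<xi>" and ?B = "BijGroup (carrier \<Gamma>)" and ?l = "left_regular \<Gamma>"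
  interpret B: group ?B by (rule group_BijGroup)
  have cB: "carrier ?B = Bij (carrier \<Gamma>)" by (simp add: BijGroup_def)
  have l: "?l \<gamma> \<in> carrier ?B" if "\<gamma> \<in> carrier \<Gamma>" for \<gamma>
    using that by (simp add: cB left_regular_Bij \<Gamma>)
  have a: "?\<alpha> g \<in> carrier ?B" if "g \<in> carrier A" for g
    using that by (simp add: cB yielded_embedding_Bij)
  have conj: "?l \<gamma> \<otimes>\<^bsub>?B\<^esub> ?\<alpha> g \<otimes>\<^bsub>?B\<^esub> inv\<^bsub>?B\<^esub> ?l \<gamma> = ?\<alpha> (g \<oplus> \<xi> \<gamma> \<otimes> g)"
    if "\<gamma> \<in> carrier \<Gamma>" "g \<in> carrier A" for \<gamma> g
    using that by (simp add: left_regular_yielded_embedding B.m_assoc l a xi_closed A.rng_m_closed)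
  have surj: "\<exists>h\<in>carrier A. h \<oplus> \<xi> \<gamma> \<otimes> h = g" if \<gamma>: "\<gamma> \<in> carrier \<Gamma>" and g: "g \<in> carrier A" for \<gamma> g
  proof -
    define d where "d = inv\<^bsub>\<Gamma>\<^esub> \<gamma>"
    have d: "d \<in> carrier \<Gamma>" "\<gamma> \<otimes>\<^bsub>\<Gamma>\<^esub> d = \<one>\<^bsub>\<Gamma>\<^esub>"
      using \<gamma> by (auto simp: d_def)
    note [simp] = \<gamma> g d xi_closed A.rng_m_closed
    have "\<xi> \<one>\<^bsub>\<Gamma>\<^esub> = \<zero>"
    proof -
      obtain e where e: "e \<in> carrier \<Gamma>" "\<xi> e = \<zero>"
        using xi_bij by (metis A.zero_closed bij_betw_def imageE)
      show ?thesis
        using xi_mult[of "\<one>\<^bsub>\<Gamma>\<^esub>" e] e rng_r_zero[of "\<xi> \<one>\<^bsub>\<Gamma>\<^esub>"] by simp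
    qed
    then have z: "\<xi> \<gamma> \<oplus> \<xi> d \<oplus> \<xi> \<gamma> \<otimes> \<xi> d = \<zero>"
      using xi_mult[of \<gamma> d] by simp
    define h where "h = g \<oplus> \<xi> d \<otimes> g"
    have "h \<oplus> \<xi> \<gamma> \<otimes> h = g \<oplus> (\<xi> \<gamma> \<oplus> \<xi> d \<oplus> \<xi> \<gamma> \<otimes> \<xi> d) \<otimes> g"
      by (simp add: h_def rng_r_distr A.rng_l_distr A.rng_m_assoc A.a_ac)
    also have "\<dots> = g"
      using rng_r_zero[of g] A.rng_m_comm[of g \<zero>] by (simp add: z)
    finally show ?thesis
      by (intro bexI[of _ h]) (simp_all add: h_def)
  qed
  show ?thesis
    unfolding lambda_invariant_def
  proof (intro ballI equalityI subsetI)
    fix \<gamma> f assume \<gamma>: "\<gamma> \<in> carrier \<Gamma>"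
      and "f \<in> ?l \<gamma> <#\<^bsub>?B\<^esub> ?\<alpha> ` carrier A #>\<^bsub>?B\<^esub> inv\<^bsub>?B\<^esub> ?l \<gamma>"
    then obtain g where "g \<in> carrier A" "f = ?l \<gamma> \<otimes>\<^bsub>?B\<^esub> ?\<alpha> g \<otimes>\<^bsub>?B\<^esub> inv\<^bsub>?B\<^esub> ?l \<gamma>"
      by (auto simp: l_coset_def r_coset_def)
    then show "f \<in> ?\<alpha> ` carrier A"
      using \<gamma> by (simp add: conj xi_closed A.rng_m_closed)
  next
    fix \<gamma> f assume \<gamma>: "\<gamma> \<in> carrier \<Gamma>" and "f \<in> ?\<alpha> ` carrier A"
    then obtain h where "h \<in> carrier A" "f = ?l \<gamma> \<otimes>\<^bsub>?B\<^esub> ?\<alpha> h \<otimes>\<^bsub>?B\<^esub> inv\<^bsub>?B\<^esub> ?l \<gamma>"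
      using surj conj by (smt (verit) imageE)
    then show "f \<in> ?l \<gamma> <#\<^bsub>?B\<^esub> ?\<alpha> ` carrier A #>\<^bsub>?B\<^esub> inv\<^bsub>?B\<^esub> ?l \<gamma>"
      by (auto simp: l_coset_def r_coset_def)
  qed
qed

end

end

theory Submission
  imports Defs
begin

text \<open>
  Regularity makes \<open>\<alpha>\<close> an isomorphism from \<open>(G, +)\<close> onto its image, so taking preimages under
  \<open>\<alpha>\<close> matches the subgroups of \<open>\<alpha>(G)\<close> with the additive subgroups of \<open>A\<close>, in an
  inclusion-preserving way. What remains is to see which additive subgroups \<open>J\<close> have a
  \<open>\<lambda>(\<Gamma>)\<close>-invariant image. Conjugation by \<open>\<lambda>(\<gamma>)\<close> carries \<open>\<alpha>(g)\<close> to
  \<open>\<alpha>(g + \<xi>(\<gamma>) \<cdot> g)\<close> (lemma \<open>conj_yielded_embedding\<close>), so invariance of \<open>\<alpha>(J)\<close> says that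
  \<open>g + \<xi>(\<gamma>) \<cdot> g \<in> J\<close> for all \<open>g \<in> J\<close> and all \<open>\<gamma>\<close>. As \<open>J\<close> is a subgroup, the summand \<open>g\<close>
  may be cancelled, and as \<open>\<xi>\<close> is onto \<open>A\<close>, the factors \<open>\<xi>(\<gamma>)\<close> are all the elements of \<open>A\<close>:
  the condition is that \<open>J\<close> is an ideal (lemma \<open>invariant_image_iff_ideal\<close>).

  An inclusion-preserving bijection whose inverse also preserves inclusion transports joins and meets. Since an
  intersection of ideals is an ideal, the ideals form a lattice, hence so do the invariant
  subgroups, and the correspondence is an isomorphism of lattices.
\<close>

section \<open>Order isomorphisms and lattices\<close>

text \<open>
  Being a least upper bound of two elements is expressed by the order alone, hence transported
  along the isomorphism; so the joins that exist in \<open>L\<close> yield joins in \<open>K\<close>.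
\<close>

lemma order_isomorphism_joins:
  assumes K: "partial_order K" and L: "upper_semilattice L"
    and bij: "bij_betw \<Phi> (carrier K) (carrier L)"
    and le: "\<And>x y. \<lbrakk>x \<in> carrier K; y \<in> carrier K\<rbrakk> \<Longrightarrow> \<Phi> x \<sqsubseteq>\<^bsub>L\<^esub> \<Phi> y \<longleftrightarrow> x \<sqsubseteq>\<^bsub>K\<^esub> y"
  shows "upper_semilattice K"
    and "\<lbrakk>x \<in> carrier K; y \<in> carrier K\<rbrakk> \<Longrightarrow> \<Phi> (x \<squnion>\<^bsub>K\<^esub> y) = \<Phi> x \<squnion>\<^bsub>L\<^esub> \<Phi> y"
proof -
  interpret K: partial_order K by (rule K)
  interpret L: upper_semilattice L by (rule L)
  have closed: "\<Phi> x \<in> carrier L" if "x \<in> carrier K" for x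
    using bij that by (rule bij_betw_apply)
  have onto: "\<exists>x\<in>carrier K. \<Phi> x = z" if "z \<in> carrier L" for z
    using bij that by (metis bij_betw_imp_surj_on imageE)
  have Upper_iff: "\<Phi> u \<in> Upper L {\<Phi> x, \<Phi> y} \<longleftrightarrow> u \<in> Upper K {x, y}"
    if "x \<in> carrier K" "y \<in> carrier K" "u \<in> carrier K" for x y u
    using that by (auto simp: Upper_def le closed)
  have least_iff: "least L (\<Phi> s) (Upper L {\<Phi> x, \<Phi> y}) \<longleftrightarrow> least K s (Upper K {x, y})"
    if xy: "x \<in> carrier K" "y \<in> carrier K" and s: "s \<in> carrier K" for x y s
  proof -
    have "Upper L {\<Phi> x, \<Phi> y} = \<Phi> ` Upper K {x, y}"
    proof (intro equalityI subsetI)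
      fix z assume z: "z \<in> Upper L {\<Phi> x, \<Phi> y}"
      then have "z \<in> carrier L" by (simp add: Upper_def)
      then obtain u where "u \<in> carrier K" "\<Phi> u = z" using onto by blast
      then show "z \<in> \<Phi> ` Upper K {x, y}" using z xy Upper_iff by blast
    next
      fix z assume "z \<in> \<Phi> ` Upper K {x, y}"
      then obtain u where "u \<in> Upper K {x, y}" "z = \<Phi> u" by blast
      moreover from this have "u \<in> carrier K" by (simp add: Upper_def)
      ultimately show "z \<in> Upper L {\<Phi> x, \<Phi> y}" using xy Upper_iff by blast
    qed
    moreover have "Upper K {x, y} \<subseteq> carrier K"
      by simp
    moreover from this have "\<Phi> ` Upper K {x, y} \<subseteq> carrier L"
      using closed by blast
    moreover have "(\<forall>u\<in>Upper K {x, y}. \<Phi> s \<sqsubseteq>\<^bsub>L\<^esub> \<Phi> u) \<longleftrightarrow> (\<forall>u\<in>Upper K {x, y}. s \<sqsubseteq>\<^bsub>K\<^esub> u)"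
      using s by (intro ball_cong) (simp_all add: le Upper_def)
    ultimately show ?thesis
      using Upper_iff[OF xy s] by (simp add: least_def)
  qed
  show ups: "upper_semilattice K"
  proof
    fix x y assume xy: "x \<in> carrier K" "y \<in> carrier K"
    then obtain t where t: "least L t (Upper L {\<Phi> x, \<Phi> y})"
      using L.sup_of_two_exists closed by blast
    then have "t \<in> carrier L" by (rule least_closed)
    then obtain s where "s \<in> carrier K" "\<Phi> s = t" using onto by blast
    then show "\<exists>s. least K s (Upper K {x, y})" using t xy least_iff by blast
  qed
  interpret K: upper_semilattice K by (rule ups)
  show "\<Phi> (x \<squnion>\<^bsub>K\<^esub> y) = \<Phi> x \<squnion>\<^bsub>L\<^esub> \<Phi> y" if xy: "x \<in> carrier K" "y \<in> carrier K"
  proof (rule L.least_unique)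
    have "least K (x \<squnion>\<^bsub>K\<^esub> y) (Upper K {x, y})"
      using xy by (intro K.weak.joinI[where P = "\<lambda>s. least K s (Upper K {x, y})"])
    then show "least L (\<Phi> (x \<squnion>\<^bsub>K\<^esub> y)) (Upper L {\<Phi> x, \<Phi> y})"
      using xy by (simp add: least_iff)
    show "least L (\<Phi> x \<squnion>\<^bsub>L\<^esub> \<Phi> y) (Upper L {\<Phi> x, \<Phi> y})"
      using xy
      by (intro L.weak.joinI[where P = "\<lambda>s. least L s (Upper L {\<Phi> x, \<Phi> y})"])
        (simp_all add: closed)
  qed
qed

lemma order_isomorphism_lattice_isomorphic:
  assumes K: "partial_order K" and L: "lattice L"
    and bij: "bij_betw \<Phi> (carrier K) (carrier L)"
    and le: "\<And>x y. \<lbrakk>x \<in> carrier K; y \<in> carrier K\<rbrakk> \<Longrightarrow> \<Phi> x \<sqsubseteq>\<^bsub>L\<^esub> \<Phi> y \<longleftrightarrow> x \<sqsubseteq>\<^bsub>K\<^esub> y"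
  shows "lattice_isomorphic K L"
proof -
  interpret K: partial_order K by (rule K)
  interpret L: lattice L by (rule L)
  have dual_L: "upper_semilattice (inv_gorder L)"
    using L.dual_lattice by (rule lattice.axioms(1))
  note joins = order_isomorphism_joins[OF K L.upper_semilattice_axioms bij le]
  \<comment> \<open>Meets are the joins of the dual orders.\<close>
  have meets: "upper_semilattice (inv_gorder K)"
    "\<lbrakk>x \<in> carrier K; y \<in> carrier K\<rbrakk> \<Longrightarrow> \<Phi> (x \<sqinter>\<^bsub>K\<^esub> y) = \<Phi> x \<sqinter>\<^bsub>L\<^esub> \<Phi> y" for x y
    using order_isomorphism_joins[OF K.dual_order dual_L, of \<Phi>] bij le by simp_all
  interpret KU: upper_semilattice K by (rule joins(1))
  interpret KD: upper_semilattice "inv_gorder K" by (rule meets(1))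
  have "lattice K"
    using KD.sup_of_two_exists by unfold_locales simp
  then show ?thesis
    using bij joins(2) meets(2) L unfolding lattice_isomorphic_def join_pres_def meet_pres_def
    by blast
qed

lemma partial_order_inclusion_order: "partial_order (inclusion_order S)"
  by unfold_locales (auto simp: inclusion_order_def)

lemma lattice_inclusion_order:
  assumes top: "T \<in> S" "\<And>X. X \<in> S \<Longrightarrow> X \<subseteq> T"
    and Inter: "\<And>F. \<lbrakk>F \<subseteq> S; F \<noteq> {}\<rbrakk> \<Longrightarrow> \<Inter>F \<in> S"
  shows "lattice (inclusion_order S)"
proof -
  interpret partial_order "inclusion_order S" by (rule partial_order_inclusion_order)
  have "complete_lattice (inclusion_order S)"
  proof (rule complete_lattice_criterion1)
    show "\<exists>g. greatest (inclusion_order S) g (carrier (inclusion_order S))"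
      using top by (auto simp: greatest_def inclusion_order_def)
    fix F assume F: "F \<subseteq> carrier (inclusion_order S)" "F \<noteq> {}"
    then have "\<Inter>F \<in> S"
      using Inter by (simp add: inclusion_order_def)
    with F have "greatest (inclusion_order S) (\<Inter>F) (Lower (inclusion_order S) F)"
      by (auto simp: greatest_def Lower_def inclusion_order_def)
    then show "\<exists>i. greatest (inclusion_order S) i (Lower (inclusion_order S) F)" ..
  qed
  then show ?thesis
    by (rule complete_lattice_lattice)
qed

lemma (in comm_rng) lattice_ideal_lattice: "lattice (ideal_lattice A)"
  unfolding ideal_lattice_def
proof (rule lattice_inclusion_order[where T = "carrier A"])
  show "carrier A \<in> {J. rng_ideal J A}"
    using add.subgroup_self by (auto simp: rng_ideal_def additive_subgroup_def rng_m_closed)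
  show "X \<subseteq> carrier A" if "X \<in> {J. rng_ideal J A}" for X
    using that additive_subgroup.a_subset by (auto simp: rng_ideal_def)
  show "\<Inter>F \<in> {J. rng_ideal J A}" if F: "F \<subseteq> {J. rng_ideal J A}" "F \<noteq> {}" for F
  proof -
    have "subgroup (\<Inter>F) (add_monoid A)"
      using F by (intro add.subgroups_Inter) (auto simp: rng_ideal_def additive_subgroup_def)
    then show ?thesis
      using F by (auto simp: rng_ideal_def additive_subgroup_def)
  qed
qed

section \<open>Invariance under the left regular representation\<close>

lemma left_regular_hom:
  assumes "group H"
  shows "group_hom H (BijGroup (carrier H)) (left_regular H)"
proof -
  interpret H: group H by fact
  note Bij = left_regular_Bij[OF assms]
  have "left_regular H (x \<otimes>\<^bsub>H\<^esub> y)
      = left_regular H x \<otimes>\<^bsub>BijGroup (carrier H)\<^esub> left_regular H y"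
    if "x \<in> carrier H" "y \<in> carrier H" for x y
    unfolding Bij_group_mult[OF Bij[OF that(1)] Bij[OF that(2)]]
    using that by (auto simp: compose_def left_regular_def H.m_assoc)
  moreover have "left_regular H x \<in> carrier (BijGroup (carrier H))" if "x \<in> carrier H" for x
    using that by (simp add: BijGroup_def left_regular_Bij assms)
  ultimately show ?thesis
    using assms group_BijGroup
    by (auto simp: group_hom_def group_hom_axioms_def hom_def)
qed

text \<open>
  It is enough that conjugation maps \<open>M\<close> into itself: conjugation by \<open>\<lambda>(\<gamma>\<^sup>-\<^sup>1) = \<lambda>(\<gamma>)\<^sup>-\<^sup>1\<close> then
  does so too, which gives the opposite inclusion.
\<close>

lemma lambda_invariant_iff:
  fixes H (structure)
  assumes H: "group H" and M: "M \<subseteq> Bij (carrier H)"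
  defines "B \<equiv> BijGroup (carrier H)"
  shows "lambda_invariant H M \<longleftrightarrow>
    (\<forall>c\<in>carrier H. \<forall>f\<in>M. left_regular H c \<otimes>\<^bsub>B\<^esub> f \<otimes>\<^bsub>B\<^esub> inv\<^bsub>B\<^esub> left_regular H c \<in> M)"
    (is "_ \<longleftrightarrow> (\<forall>c\<in>carrier H. \<forall>f\<in>M. ?conj c f \<in> M)")
proof -
  interpret left_regular: group_hom H B "left_regular H"
    unfolding B_def by (rule left_regular_hom[OF H])
  have coset: "left_regular H c <#\<^bsub>B\<^esub> M #>\<^bsub>B\<^esub> inv\<^bsub>B\<^esub> left_regular H c = ?conj c ` M" for c
    by (auto simp: l_coset_def r_coset_def)
  have undo: "?conj c (?conj (inv c) f) = f" if c: "c \<in> carrier H" and f: "f \<in> M" for c f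
  proof -
    have "f \<in> carrier B" using f M by (auto simp: B_def BijGroup_def)
    moreover define l where "l = left_regular H c"
    moreover have "l \<in> carrier B" using c by (simp add: l_def)
    moreover have "left_regular H (inv c) = inv\<^bsub>B\<^esub> l" using c by (simp add: l_def)
    ultimately show ?thesis
      using left_regular.H.m_assoc[of l "inv\<^bsub>B\<^esub> l" f, symmetric]
      by (simp add: left_regular.H.m_assoc)
  qed
  show ?thesis
    unfolding lambda_invariant_def B_def[symmetric] coset
  proof (intro iffI ballI)
    fix c f assume "\<forall>c\<in>carrier H. ?conj c ` M = M" "c \<in> carrier H" "f \<in> M"
    then show "?conj c f \<in> M" by blast
  next
    fix c assume *: "\<forall>c\<in>carrier H. \<forall>f\<in>M. ?conj c f \<in> M" and c: "c \<in> carrier H"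
    have "f \<in> ?conj c ` M" if f: "f \<in> M" for f
    proof (rule image_eqI)
      show "f = ?conj c (?conj (inv c) f)" using undo[OF c f] by simp
      show "?conj (inv c) f \<in> M" using * c f left_regular.G.inv_closed by blast
    qed
    then show "?conj c ` M = M" using * c by auto
  qed
qed

section \<open>Ideals and invariant subgroups\<close>

context
  fixes A :: "('a, 'm) ring_scheme" (structure) and \<Gamma> :: "('b, 'n) monoid_scheme" and \<xi>
  assumes A: "comm_rng A" and \<Gamma>: "group \<Gamma>" and \<xi>: "\<xi> \<in> iso \<Gamma> (circle_group A)"
begin

interpretation A: comm_rng A by (rule A)
interpretation \<Gamma>: group \<Gamma> by (rule \<Gamma>)

abbreviation (input) \<alpha> where "\<alpha> \<equiv> yielded_embedding A \<Gamma> \<xi>"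
abbreviation (input) B where "B \<equiv> BijGroup (carrier \<Gamma>)"

interpretation \<alpha>: group_hom "add_monoid A" B \<alpha>
  using yielded_embedding_regular[OF A \<Gamma> \<xi>] A.a_group group_BijGroup
  by (auto simp: regular_embedding_def group_hom_def group_hom_axioms_def)

lemma inj_yielded_embedding: "inj_on \<alpha> (carrier A)"
  using yielded_embedding_regular[OF A \<Gamma> \<xi>] by (simp add: regular_embedding_def)

text \<open>
  Here the two operations of the ring meet: \<open>\<lambda>(\<gamma>)\<close> acts on \<open>G\<close> as \<open>x \<mapsto> \<xi>(\<gamma>) + (1 + \<xi>(\<gamma>)) \<cdot> x\<close>,
  an affine map, and conjugating a translation by an affine map applies the linear part to the
  translation vector.
\<close>

lemma conj_yielded_embedding:
  assumes c: "c \<in> carrier \<Gamma>" and g: "g \<in> carrier A"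
  shows "left_regular \<Gamma> c \<otimes>\<^bsub>B\<^esub> \<alpha> g \<otimes>\<^bsub>B\<^esub> inv\<^bsub>B\<^esub> left_regular \<Gamma> c = \<alpha> (g \<oplus> \<xi> c \<otimes> g)"
proof -
  have "left_regular \<Gamma> c \<in> carrier B"
    using c by (simp add: BijGroup_def left_regular_Bij \<Gamma>)
  moreover have "g \<oplus> \<xi> c \<otimes> g \<in> carrier A"
    using c g by (simp add: xi_closed[OF A \<Gamma> \<xi>] A.rng_m_closed)
  then have "\<alpha> (g \<oplus> \<xi> c \<otimes> g) \<in> carrier B"
    using \<alpha>.hom_closed by simp
  ultimately show ?thesis
    using assms left_regular_yielded_embedding[OF A \<Gamma> \<xi> c g]
    by (simp add: \<alpha>.H.m_assoc)
qed

text \<open>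
  Invariance is closure of \<open>J\<close> under \<open>g \<mapsto> g + \<xi>(\<gamma>) \<cdot> g\<close>; within a subgroup this is closure under
  \<open>g \<mapsto> \<xi>(\<gamma>) \<cdot> g\<close>, and surjectivity of \<open>\<xi>\<close> turns it into absorption of all of \<open>A\<close>.
\<close>

lemma invariant_image_iff_ideal:
  assumes J: "additive_subgroup J A"
  shows "lambda_invariant \<Gamma> (\<alpha> ` J) \<longleftrightarrow> rng_ideal J A"
proof -
  interpret J: additive_subgroup J A by (rule J)
  have sub: "g \<in> carrier A" if "g \<in> J" for g
    using J.a_subset that by blast
  have img: "\<alpha> g \<in> \<alpha> ` J \<longleftrightarrow> g \<in> J" if "g \<in> carrier A" for g
    by (rule inj_on_image_mem_iff[OF inj_yielded_embedding that J.a_subset])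
  have cancel: "g \<oplus> x \<otimes> g \<in> J \<longleftrightarrow> x \<otimes> g \<in> J" if "g \<in> J" "x \<in> carrier A" for g x
  proof
    assume "g \<oplus> x \<otimes> g \<in> J"
    then have "\<ominus> g \<oplus> (g \<oplus> x \<otimes> g) \<in> J" using that by blast
    then show "x \<otimes> g \<in> J"
      using that sub by (simp add: A.rng_m_closed A.r_neg2 A.r_neg1)
  qed (use that in blast)
  have "\<alpha> ` J \<subseteq> Bij (carrier \<Gamma>)"
    using sub yielded_embedding_Bij[OF A \<Gamma> \<xi>] by blast
  then have "lambda_invariant \<Gamma> (\<alpha> ` J) \<longleftrightarrow>
      (\<forall>c\<in>carrier \<Gamma>. \<forall>g\<in>J. \<alpha> (g \<oplus> \<xi> c \<otimes> g) \<in> \<alpha> ` J)"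
    by (simp add: lambda_invariant_iff[OF \<Gamma>] conj_yielded_embedding sub)
  also have "\<dots> \<longleftrightarrow> (\<forall>c\<in>carrier \<Gamma>. \<forall>g\<in>J. \<xi> c \<otimes> g \<in> J)"
    using sub by (simp add: img cancel xi_closed[OF A \<Gamma> \<xi>] A.rng_m_closed)
  also have "\<dots> \<longleftrightarrow> (\<forall>a\<in>carrier A. \<forall>g\<in>J. a \<otimes> g \<in> J)"
    unfolding bij_betw_imp_surj_on[OF xi_bij[OF A \<Gamma> \<xi>], symmetric] by simp
  also have "\<dots> \<longleftrightarrow> rng_ideal J A"
    using J by (simp add: rng_ideal_def)
  finally show ?thesis .
qed

lemma invariant_subgroup_image_iff:
  assumes J: "J \<subseteq> carrier A"
  shows "subgroup (\<alpha> ` J) B \<and> lambda_invariant \<Gamma> (\<alpha> ` J) \<longleftrightarrow> rng_ideal J A"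
proof -
  have "additive_subgroup J A" if "subgroup (\<alpha> ` J) B"
  proof -
    interpret M: subgroup "\<alpha> ` J" B by (rule that)
    have mem: "g \<in> J" if "\<alpha> g \<in> \<alpha> ` J" "g \<in> carrier A" for g
      using that J inj_yielded_embedding by (auto dest: inj_onD)
    have sub: "g \<in> carrier A" if "g \<in> J" for g
      using J that by blast
    show ?thesis
    proof (rule additive_subgroup.intro, rule A.add.subgroupI)
      show "J \<subseteq> carrier A" by (rule J)
      show "J \<noteq> {}" using M.one_closed by blast
      fix a assume a: "a \<in> J"
      then have "inv\<^bsub>B\<^esub> \<alpha> a \<in> \<alpha> ` J" by (intro M.m_inv_closed imageI)
      then show "\<ominus> a \<in> J"
        using mem[of "\<ominus> a"] \<alpha>.hom_inv[of a] a sub by (simp add: a_inv_def[of A, symmetric])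
      fix b assume b: "b \<in> J"
      with a have "\<alpha> a \<otimes>\<^bsub>B\<^esub> \<alpha> b \<in> \<alpha> ` J" by (intro M.m_closed imageI)
      then show "a \<oplus> b \<in> J"
        using mem[of "a \<oplus> b"] \<alpha>.hom_mult[of a b] a b sub by simp
    qed
  qed
  moreover have "subgroup (\<alpha> ` J) B" if "additive_subgroup J A"
    using that by (intro \<alpha>.subgroup_img_is_subgroup) (rule additive_subgroup.a_subgroup)
  ultimately show ?thesis
    using invariant_image_iff_ideal by (auto simp: rng_ideal_def)
qed

lemma invariant_subgroups_isomorphic_ideals:
  "lattice_isomorphic (invariant_subgroup_lattice \<Gamma> (\<alpha> ` carrier A)) (ideal_lattice A)"
proof (rule order_isomorphism_lattice_isomorphic)
  let ?K = "invariant_subgroup_lattice \<Gamma> (\<alpha> ` carrier A)"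
  let ?\<Phi> = "\<lambda>M. \<alpha> -` M \<inter> carrier A"
  have K: "M \<in> carrier ?K \<longleftrightarrow>
      subgroup M B \<and> M \<subseteq> \<alpha> ` carrier A \<and> lambda_invariant \<Gamma> M" for M
    by (simp add: invariant_subgroup_lattice_def inclusion_order_def)
  have L: "J \<in> carrier (ideal_lattice A) \<longleftrightarrow> rng_ideal J A" for J
    by (simp add: ideal_lattice_def inclusion_order_def)
  have ideal_sub: "J \<subseteq> carrier A" if "rng_ideal J A" for J
    using that additive_subgroup.a_subset by (auto simp: rng_ideal_def)
  have image_vimage: "\<alpha> ` ?\<Phi> M = M" if "M \<subseteq> \<alpha> ` carrier A" for M
    using that by blast
  have vimage_image: "?\<Phi> (\<alpha> ` J) = J" if "J \<subseteq> carrier A" for J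
    using that inj_yielded_embedding by (auto dest: inj_onD)
  show "partial_order ?K"
    by (simp add: invariant_subgroup_lattice_def partial_order_inclusion_order)
  show "lattice (ideal_lattice A)"
    by (rule A.lattice_ideal_lattice)
  show "bij_betw ?\<Phi> (carrier ?K) (carrier (ideal_lattice A))"
  proof (rule bij_betwI[where g = "\<lambda>J. \<alpha> ` J"])
    show "?\<Phi> \<in> carrier ?K \<rightarrow> carrier (ideal_lattice A)"
    proof
      fix M assume M: "M \<in> carrier ?K"
      then have "\<alpha> ` ?\<Phi> M = M" by (simp add: K image_vimage)
      with M invariant_subgroup_image_iff[of "?\<Phi> M"] show "?\<Phi> M \<in> carrier (ideal_lattice A)"
        by (simp add: K L)
    qed
    show "(\<lambda>J. \<alpha> ` J) \<in> carrier (ideal_lattice A) \<rightarrow> carrier ?K"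
    proof
      fix J assume J: "J \<in> carrier (ideal_lattice A)"
      then have "J \<subseteq> carrier A" by (simp add: L ideal_sub)
      with J invariant_subgroup_image_iff[of J] show "\<alpha> ` J \<in> carrier ?K"
        by (auto simp: K L)
    qed
    show "\<alpha> ` ?\<Phi> M = M" if "M \<in> carrier ?K" for M
      using that by (simp add: K image_vimage)
    show "?\<Phi> (\<alpha> ` J) = J" if "J \<in> carrier (ideal_lattice A)" for J
      using that by (simp add: L ideal_sub vimage_image)
  qed
  show "?\<Phi> M \<sqsubseteq>\<^bsub>ideal_lattice A\<^esub> ?\<Phi> N \<longleftrightarrow> M \<sqsubseteq>\<^bsub>?K\<^esub> N"
    if "M \<in> carrier ?K" "N \<in> carrier ?K" for M N
  proof -
    have "?\<Phi> M \<subseteq> ?\<Phi> N \<longleftrightarrow> M \<subseteq> N"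
      using that by (metis K image_mono image_vimage vimage_mono Int_mono order_refl)
    then show ?thesis
      by (simp add: ideal_lattice_def invariant_subgroup_lattice_def inclusion_order_def)
  qed
qed

end

theorem theorem3p2:
  fixes p :: nat
    and A :: "('a, 'm) ring_scheme"
    and \<Gamma> :: "('b, 'n) monoid_scheme"
    and \<xi> :: "'b \<Rightarrow> 'a"
  assumes "prime p"
    and "comm_rng A" and "nilpotent_rng A" and "finite_p_group p (add_monoid A)"
    and "comm_group \<Gamma>" and "finite_p_group p \<Gamma>"
    and "\<xi> \<in> iso \<Gamma> (circle_group A)"
  shows "lattice_isomorphic
           (invariant_subgroup_lattice \<Gamma> (yielded_embedding A \<Gamma> \<xi> ` carrier A))
           (ideal_lattice A)"
  using assms by (intro invariant_subgroups_isomorphic_ideals) (auto intro: comm_group.axioms(2))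

end
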